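(* Let $n$ be a non-negative integer and let $v$ be a real number. Then $$\sum_{k=0}^n(-1)^k\binom nk2^{-k}\binom{2k+v}{(2k+v)/2}\binom{k+v}{v/2}^{-1}=\begin{cases}2^{-n}\binom n{n/2}\binom{(n+v)/2}{v/2}^{-1}, & \text{if } n \text{ is even},\\ 0, & \text{if } n\text{ is odd}.\end{cases}$$
   Context: For non-negative integers the binomial coefficients are the usual ones (zero when the lower index exceeds the upper). Generalized binomial coefficients are defined for complex numbers $a,b$, excluding the set of negative integers, by $\binom ab=\frac{\Gamma(a+1)}{\Gamma(b+1)\Gamma(a-b+1)}$; the identity is read for those real $v$ for which the binomial coefficients in it are so defined. The notation $\binom ab^{-1}$ means the reciprocal $1/\binom ab$. *)

theory Defs
  imports "HOL-Analysis.Gamma_Function"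
begin

definition neg_Ints :: "complex set" where
  "neg_Ints = of_int ` {m. m < 0}"

(* For a and b outside neg_Ints, the factor Gamma (a - b + 1) may still sit at a pole.
   The library sets Gamma to 0 there, so the quotient is 0, in agreement with the usual
   reading of 1/Gamma as an entire function. *)
definition gen_binomial :: "complex \<Rightarrow> complex \<Rightarrow> complex" where
  "gen_binomial a b = Gamma (a + 1) / (Gamma (b + 1) * Gamma (a - b + 1))"

definition gen_binomial_defined :: "complex \<Rightarrow> complex \<Rightarrow> bool" where
  "gen_binomial_defined a b \<longleftrightarrow> a \<notin> neg_Ints \<and> b \<notin> neg_Ints"

end

theory Submission
  imports Defs
begin

text \<open>
  With \<open>b = (v + 1) / 2\<close>, Legendre duplication turns the sum into the terminating
  hypergeometric series \<open>\<^sub>2F\<^sub>1(-n, b; 2b; 2)\<close>. Zeilberger's algorithm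
  yields the recurrence \<open>(n + 1 + 2b) S\<^sub>n\<^sub>+\<^sub>2 = (n + 1) S\<^sub>n\<close>,
  which together with \<open>S\<^sub>0 = 1\<close> and \<open>S\<^sub>1 = 0\<close> determines all the sums.
\<close>

text \<open>The binomial factor is left out so that the term does not depend on \<open>n\<close>:
  sums for different \<open>n\<close> then differ only in their binomial coefficients. Since
  \<open>(n choose k) * (-2) ^ k\<close> is the Pochhammer symbol of \<open>-n\<close> times
  \<open>2 ^ k / k!\<close>, \<open>hyp_sum\<close> is the series at argument 2.\<close>

definition hyp_term :: "'a::field_char_0 \<Rightarrow> nat \<Rightarrow> 'a" where
  "hyp_term b k = (-2) ^ k * pochhammer b k / pochhammer (2 * b) k"

definition hyp_sum :: "'a::field_char_0 \<Rightarrow> nat \<Rightarrow> 'a" where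
  "hyp_sum b n = (\<Sum>k\<le>n. of_nat (n choose k) * hyp_term b k)"

lemma hyp_term_Suc:
  assumes "2 * b + of_nat k \<noteq> 0"
  shows "(2 * b + of_nat k) * hyp_term b (Suc k) = -2 * (b + of_nat k) * hyp_term b k"
  using assms unfolding hyp_term_def pochhammer_Suc power_Suc
  by (simp only: mult.commute[of "pochhammer (2 * b) k"] times_divide_eq_right
      mult_divide_mult_cancel_left_if mult_ac) simp

text \<open>The Zeilberger certificate with the hypergeometric terms divided out: it is the
  coefficient of \<open>hyp_term b (Suc m)\<close> in the telescoping step from \<open>m\<close> to
  \<open>Suc m\<close>.\<close>

lemma choose_certificate:
  fixes b :: "'a::field_char_0"
  shows "(of_nat n + 1 + 2 * b) * of_nat (Suc (Suc n) choose Suc m)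
           - (of_nat n + 1) * of_nat (n choose Suc m) - (2 * b + of_nat m) * of_nat (Suc n choose m)
         = 2 * (b + of_nat (Suc m)) * of_nat (Suc n choose Suc m)"
proof -
  \<comment> \<open>By Pascal's rule the other two coefficients are \<open>x + y\<close> and
    \<open>z + (x + y)\<close>, so two linear relations among \<open>x\<close>, \<open>y\<close>,
    \<open>z\<close> suffice.\<close>
  define x y z where "x = (of_nat (n choose m) :: 'a)" and "y = (of_nat (n choose Suc m) :: 'a)"
    and "z = (of_nat (Suc n choose m) :: 'a)"
  have "Suc m * (Suc n choose Suc m) = Suc n * (n choose m)"
    by (rule Suc_times_binomial)
  hence 1: "(of_nat m + 1) * (x + y) = (of_nat n + 1) * x"
    unfolding x_def y_def by (simp flip: of_nat_mult of_nat_add of_nat_Suc add: algebra_simps)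
  \<comment> \<open>This is \<open>(n + 1 - m) * (Suc n choose m) = (n + 1) * (n choose m)\<close>,
    written without subtraction on naturals.\<close>
  have "Suc n * (n choose m) + m * (Suc n choose m) = Suc n * (Suc n choose m)"
  proof (cases m)
    case (Suc j)
    show ?thesis
      unfolding Suc using Suc_times_binomial[of j n] by (simp add: algebra_simps)
  qed simp
  hence "of_nat (Suc n * (n choose m) + m * (Suc n choose m)) = (of_nat (Suc n * (Suc n choose m)) :: 'a)"
    by (rule arg_cong)
  hence 2: "(of_nat n + 1) * x + of_nat m * z = (of_nat n + 1) * z"
    unfolding x_def z_def of_nat_add of_nat_mult of_nat_Suc by (simp add: add.commute)
  have "(of_nat n + 1 + 2 * b) * (z + (x + y)) - (of_nat n + 1) * y - (2 * b + of_nat m) * z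
      = 2 * (b + (of_nat m + 1)) * (x + y)"
    using 1 2 by algebra
  thus ?thesis
    by (simp add: x_def y_def z_def algebra_simps)
qed

text \<open>The right-hand side is the antidifference of the summand. The assumption keeps every
  denominator \<open>pochhammer (2 * b) k\<close> away from 0.\<close>

lemma hyp_sum_telescope:
  fixes b :: "'a::field_char_0"
  assumes "\<And>k. 2 * b + of_nat k \<noteq> 0"
  shows "(\<Sum>k\<le>m. ((of_nat n + 1 + 2 * b) * of_nat (Suc (Suc n) choose k)
             - (of_nat n + 1) * of_nat (n choose k)) * hyp_term b k)
         = 2 * (b + of_nat m) * of_nat (Suc n choose m) * hyp_term b m"
proof (induction m)
  case 0
  show ?case by (simp add: algebra_simps)
next
  case (Suc m)
  \<comment> \<open>The term ratio rewrites the old boundary value over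
    \<open>hyp_term b (Suc m)\<close>, so that only the certificate remains.\<close>
  have "2 * (b + of_nat m) * of_nat (Suc n choose m) * hyp_term b m
      = - (2 * b + of_nat m) * of_nat (Suc n choose m) * hyp_term b (Suc m)"
    using hyp_term_Suc[OF assms, of m] by algebra
  with Suc.IH choose_certificate[of n b m] show ?case
    unfolding sum.atMost_Suc by algebra
qed

lemma hyp_sum_extend:
  assumes "n \<le> N"
  shows "(\<Sum>k\<le>N. of_nat (n choose k) * hyp_term b k) = hyp_sum b n"
  unfolding hyp_sum_def by (rule sum.mono_neutral_right) (use assms in auto)

lemma hyp_sum_Suc_Suc:
  fixes b :: "'a::field_char_0"
  assumes "\<And>k. 2 * b + of_nat k \<noteq> 0"
  shows "(of_nat n + 1 + 2 * b) * hyp_sum b (Suc (Suc n)) = (of_nat n + 1) * hyp_sum b n"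
proof -
  have "(of_nat n + 1 + 2 * b) * hyp_sum b (Suc (Suc n)) - (of_nat n + 1) * hyp_sum b n
      = (\<Sum>k\<le>Suc (Suc n). ((of_nat n + 1 + 2 * b) * of_nat (Suc (Suc n) choose k)
             - (of_nat n + 1) * of_nat (n choose k)) * hyp_term b k)"
    by (simp only: hyp_sum_extend[of n "Suc (Suc n)" b, symmetric] hyp_sum_def[of b "Suc (Suc n)"]
        sum_distrib_left sum_subtractf left_diff_distrib mult.assoc le_SucI le_refl)
  also have "\<dots> = 0"
    \<comment> \<open>At the upper limit the boundary value contains
      \<open>Suc n choose Suc (Suc n)\<close>, which is 0.\<close>
    by (subst hyp_sum_telescope[OF assms]) (simp add: binomial_eq_0)
  finally show ?thesis by simp
qed

lemma hyp_sum_odd: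
  fixes b :: "'a::field_char_0"
  assumes "\<And>k. 2 * b + of_nat k \<noteq> 0"
  shows "hyp_sum b (Suc (2 * m)) = 0"
proof (induction m)
  case 0
  \<comment> \<open>The base case is \<open>1 - 2 * b / (2 * b)\<close>, which vanishes only because
    the quotient is genuine.\<close>
  have "b \<noteq> 0" using assms[of 0] by simp
  then show ?case by (simp add: hyp_sum_def hyp_term_def)
next
  case (Suc m)
  have "of_nat (Suc (2 * m)) + 1 + 2 * b \<noteq> 0"
    using assms[of "Suc (Suc (2 * m))"] by (simp add: algebra_simps)
  with hyp_sum_Suc_Suc[OF assms, of "Suc (2 * m)"] Suc.IH show ?case
    by simp
qed

text \<open>Halving numerator and denominator of the recurrence factor
  \<open>(2m + 1) / (2m + 1 + 2b)\<close> gives exactly the next factors of the two Pochhammer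
  symbols.\<close>

lemma hyp_sum_even:
  fixes b :: "'a::field_char_0"
  assumes "\<And>k. 2 * b + of_nat k \<noteq> 0"
  shows "hyp_sum b (2 * m) = pochhammer (1/2) m / pochhammer (b + 1/2) m"
proof (induction m)
  case 0
  show ?case by (simp add: hyp_sum_def hyp_term_def)
next
  case (Suc m)
  have nz: "of_nat (2 * m) + 1 + 2 * b \<noteq> 0"
    using assms[of "Suc (2 * m)"] by (simp add: algebra_simps)
  have "hyp_sum b (2 * Suc m) = (of_nat (2 * m) + 1) / (of_nat (2 * m) + 1 + 2 * b) * hyp_sum b (2 * m)"
    using hyp_sum_Suc_Suc[OF assms, of "2 * m"] nz by (simp add: field_simps)
  also have "(of_nat (2 * m) + 1) / (of_nat (2 * m) + 1 + 2 * b)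
      = (1/2 + of_nat m) / (b + 1/2 + of_nat m)"
  proof -
    have "(of_nat (2 * m) + 1) / (of_nat (2 * m) + 1 + 2 * b)
        = (2 * (1/2 + of_nat m)) / (2 * (b + 1/2 + of_nat m))"
      by (simp add: algebra_simps)
    thus ?thesis by (simp only: mult_divide_mult_cancel_left_if) simp
  qed
  finally show ?case
    by (simp only: Suc.IH pochhammer_Suc times_divide_times_eq) (simp only: mult.commute)
qed

text \<open>Duplication at \<open>1/2\<close> splits \<open>(2m)!\<close> into
  \<open>4 ^ m * pochhammer (1/2) m * m!\<close>. This produces the central binomial coefficient of
  the even case.\<close>

lemma pochhammer_half_eq_choose:
  "pochhammer (1/2 :: 'a::field_char_0) m = of_nat ((2 * m) choose m) * fact m / 4 ^ m"
proof -
  have "(2 :: 'a) ^ (2 * m) = 4 ^ m" by (simp add: power_mult)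
  hence "fact (2 * m) = (4 ^ m * pochhammer (1/2) m * fact m :: 'a)"
    using pochhammer_double[of "1/2 :: 'a" m] by (simp add: pochhammer_fact mult_ac)
  moreover have "of_nat ((2 * m) choose m) = (fact (2 * m) / (fact m * fact m) :: 'a)"
    by (simp add: binomial_fact mult_2)
  ultimately show ?thesis by (simp add: field_simps)
qed

text \<open>Translates definedness of the binomials into the absence of poles of
  \<open>Gamma\<close>.\<close>

lemma nonpos_Ints_add_one_iff: "z + 1 \<in> \<int>\<^sub>\<le>\<^sub>0 \<longleftrightarrow> z \<in> neg_Ints"
proof
  assume "z + 1 \<in> \<int>\<^sub>\<le>\<^sub>0"
  then obtain m where "z + 1 = of_int m" "m \<le> 0" by (elim nonpos_Ints_cases)
  then have "z = of_int (m - 1)" "m - 1 < 0" by (simp_all add: eq_diff_eq)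
  then show "z \<in> neg_Ints" unfolding neg_Ints_def by blast
next
  assume "z \<in> neg_Ints"
  then obtain m where "z = of_int m" "m < 0" unfolding neg_Ints_def by blast
  then have "z + 1 = of_int (m + 1)" "m + 1 \<le> 0" by simp_all
  then show "z + 1 \<in> \<int>\<^sub>\<le>\<^sub>0" by (metis nonpos_Ints_of_int)
qed

text \<open>All Gamma values are expressed relative to those at \<open>w + 1\<close> and
  \<open>w / 2 + 1\<close>. Duplication splits \<open>pochhammer (w + 1) (2 * k)\<close>, and its
  factor \<open>pochhammer (w / 2 + 1) k\<close> cancels.\<close>

lemma gen_binomial_quotient:
  fixes w :: complex
  assumes w: "w + 1 \<notin> \<int>\<^sub>\<le>\<^sub>0" and h: "w / 2 + 1 \<notin> \<int>\<^sub>\<le>\<^sub>0"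
  shows "gen_binomial (2 * of_nat k + w) ((2 * of_nat k + w) / 2)
           * inverse (gen_binomial (of_nat k + w) (w / 2))
         = 4 ^ k * pochhammer ((w + 1) / 2) k / pochhammer (w + 1) k"
proof -
  \<comment> \<open>Shifting right by a natural number cannot reach a pole, so none of the Gamma
    values below is the default 0.\<close>
  have nz: "z + of_nat j \<notin> \<int>\<^sub>\<le>\<^sub>0" if "z \<notin> \<int>\<^sub>\<le>\<^sub>0" for z :: complex and j
    using that nonpos_Ints_diff_Nats[of "z + of_nat j" "of_nat j"] by auto
  define A B C D where "A = Gamma (w + 1)" and "B = Gamma (w / 2 + 1)"
    and "C = Gamma (w / 2 + 1 + of_nat k)" and "D = Gamma (w + 1 + of_nat k)"
  have nz': "A \<noteq> 0" "B \<noteq> 0" "C \<noteq> 0" "D \<noteq> 0"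
    unfolding A_def B_def C_def D_def using nz w h by (simp_all add: Gamma_eq_zero_iff)
  have 1: "gen_binomial (2 * of_nat k + w) ((2 * of_nat k + w) / 2)
      = Gamma (w + 1 + of_nat (2 * k)) / (C * C)"
    by (simp add: gen_binomial_def C_def field_simps)
  have 2: "gen_binomial (of_nat k + w) (w / 2) = D / (B * C)"
    by (simp add: gen_binomial_def B_def C_def D_def field_simps)
  have "Gamma (w + 1 + of_nat (2 * k)) = A * pochhammer (w + 1) (2 * k)"
    using nz'(1) by (simp only: pochhammer_Gamma[OF w] A_def) simp
  also have "pochhammer (w + 1) (2 * k)
      = 4 ^ k * pochhammer ((w + 1) / 2) k * pochhammer (w / 2 + 1) k"
  proof -
    have "2 * ((w + 1) / 2) = w + 1" "(w + 1) / 2 + 1 / 2 = w / 2 + 1" by (simp_all add: field_simps)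
    note double = pochhammer_double[of "(w + 1) / 2" k, unfolded this]
    show ?thesis unfolding double by (simp add: power_mult)
  qed
  also have "pochhammer (w / 2 + 1) k = C / B"
    by (simp add: pochhammer_Gamma[OF h] B_def C_def)
  finally have 3: "Gamma (w + 1 + of_nat (2 * k)) = A * (4 ^ k * pochhammer ((w + 1) / 2) k * (C / B))" .
  have 4: "pochhammer (w + 1) k = D / A"
    by (simp add: pochhammer_Gamma[OF w] A_def D_def)
  show ?thesis
    unfolding 1 2 3 4 using nz' by (simp add: field_simps)
qed

theorem corollary3:
  fixes n :: nat and v :: real
  assumes "\<And>k. k \<le> n \<Longrightarrow>
      gen_binomial_defined (2 * of_nat k + of_real v) ((2 * of_nat k + of_real v) / 2)"
    and "\<And>k. k \<le> n \<Longrightarrow>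
      gen_binomial_defined (of_nat k + of_real v) (of_real v / 2)"
    and "even n \<Longrightarrow> gen_binomial_defined ((of_nat n + of_real v) / 2) (of_real v / 2)"
  shows "(\<Sum>k=0..n. (-1) ^ k * of_nat (n choose k) * 2 powi (- int k)
            * gen_binomial (2 * of_nat k + of_real v) ((2 * of_nat k + of_real v) / 2)
            * inverse (gen_binomial (of_nat k + of_real v) (of_real v / 2)))
        = (if even n
           then 2 powi (- int n) * of_nat (n choose (n div 2))
                  * inverse (gen_binomial ((of_nat n + of_real v) / 2) (of_real v / 2))
           else 0)"
proof -
  define w where "w = complex_of_real v"
  define b where "b = (w + 1) / 2"
  \<comment> \<open>The instance \<open>k = 0\<close> concerns the indices \<open>w\<close> and
    \<open>w / 2\<close>.\<close>
  have w: "w + 1 \<notin> \<int>\<^sub>\<le>\<^sub>0" and h: "w / 2 + 1 \<notin> \<int>\<^sub>\<le>\<^sub>0"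
    using assms(2)[of 0] by (simp_all add: gen_binomial_defined_def nonpos_Ints_add_one_iff w_def)
  have nz: "2 * b + of_nat k \<noteq> 0" for k
  proof
    assume "2 * b + of_nat k = 0"
    then have "w + 1 = - of_nat k" unfolding b_def by (simp add: add_eq_0_iff2 del: distrib_left_numeral)
    with w show False by simp
  qed
  have "(-1) ^ k * of_nat (n choose k) * 2 powi (- int k)
            * gen_binomial (2 * of_nat k + w) ((2 * of_nat k + w) / 2)
            * inverse (gen_binomial (of_nat k + w) (w / 2))
      = of_nat (n choose k) * hyp_term b k" for k
  proof -
    \<comment> \<open>The \<open>4 ^ k\<close> from duplication turns
      \<open>2 powi (- int k)\<close> into \<open>2 ^ k\<close>; this is where the argument 2 of the
      series comes from.\<close>
    have pow: "(-1) ^ k * 2 powi (- int k) * 4 ^ k = ((-2) ^ k :: complex)"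
      by (simp add: power_int_minus flip: power_inverse power_mult_distrib)
    have "(-1) ^ k * of_nat (n choose k) * 2 powi (- int k)
            * gen_binomial (2 * of_nat k + w) ((2 * of_nat k + w) / 2)
            * inverse (gen_binomial (of_nat k + w) (w / 2))
        = (-1) ^ k * of_nat (n choose k) * 2 powi (- int k)
            * (4 ^ k * pochhammer ((w + 1) / 2) k / pochhammer (w + 1) k)"
      by (simp only: mult.assoc gen_binomial_quotient[OF w h])
    also have "\<dots> = of_nat (n choose k) * (((-1) ^ k * 2 powi (- int k) * 4 ^ k)
            * pochhammer ((w + 1) / 2) k / pochhammer (w + 1) k)"
      by (simp add: mult_ac)
    also have "\<dots> = of_nat (n choose k) * hyp_term b k"
      unfolding pow by (simp add: hyp_term_def b_def del: distrib_left_numeral)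
    finally show ?thesis .
  qed
  then have sum: "(\<Sum>k=0..n. (-1) ^ k * of_nat (n choose k) * 2 powi (- int k)
            * gen_binomial (2 * of_nat k + of_real v) ((2 * of_nat k + of_real v) / 2)
            * inverse (gen_binomial (of_nat k + of_real v) (of_real v / 2))) = hyp_sum b n"
    unfolding hyp_sum_def w_def atLeast0AtMost by (intro sum.cong refl)
  show ?thesis
  proof (cases "even n")
    case True
    then obtain m where m: "n = 2 * m" by (elim evenE)
    \<comment> \<open>The indices differ by \<open>m\<close>, so the last Gamma factor is
      \<open>m!\<close>; it matches the \<open>fact m\<close> in
      \<open>pochhammer_half_eq_choose\<close>.\<close>
    have "gen_binomial ((of_nat n + of_real v) / 2) (of_real v / 2)
        = Gamma (w / 2 + 1 + of_nat m) / (Gamma (w / 2 + 1) * Gamma (1 + of_nat m))"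
      by (simp add: gen_binomial_def m w_def add_divide_distrib add_ac)
    also have "\<dots> = pochhammer (w / 2 + 1) m / fact m"
      by (simp add: pochhammer_Gamma[OF h] Gamma_fact)
    finally have "inverse (gen_binomial ((of_nat n + of_real v) / 2) (of_real v / 2))
        = fact m / pochhammer (w / 2 + 1) m" by simp
    moreover have "2 powi (- int n) = (1 / 4 ^ m :: complex)"
    proof -
      have "(2 :: complex) ^ (2 * m) = 4 ^ m" by (simp add: power_mult)
      then show ?thesis by (simp only: m power_int_minus power_int_of_nat inverse_eq_divide)
    qed
    \<comment> \<open>Identifies the denominator in \<open>hyp_sum_even\<close> with that of the
      reciprocal binomial.\<close>
    moreover have "b + 1 / 2 = w / 2 + 1"
      by (simp add: b_def field_simps)
    ultimately show ?thesis
      unfolding sum using True hyp_sum_even[OF nz, of m]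
      by (simp add: m pochhammer_half_eq_choose)
  next
    case False
    then obtain m where "n = Suc (2 * m)" by (metis oddE Suc_eq_plus1)
    with False hyp_sum_odd[OF nz] show ?thesis
      unfolding sum by simp
  qed
qed

end
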